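(* Let $p$ be a prime number and $m\ge 2$ a positive integer. A bicrossed product between two cyclic groups of orders $p$ and respectively $m$ is isomorphic to a semidirect product between cyclic groups of the same orders $p$ and $m$ (where either one of the two cyclic groups may be the normal factor of the semidirect product).
   Context: A matched pair of groups is a quadruple $(H,G,\alpha,\beta)$ where $H$ and $G$ are groups, $\alpha: G\times H\to H$, $\alpha(g,h)=g\triangleright h$, is a left action of the group $G$ on the set $H$, and $\beta: G\times H\to G$, $\beta(g,h)=g\triangleleft h$, is a right action of the group $H$ on the set $G$, such that for all $g,g_1,g_2\in G$, $h,h_1,h_2\in H$: $$g\triangleright(h_1h_2)=(g\triangleright h_1)\bigl((g\triangleleft h_1)\triangleright h_2\bigr),\qquad (g_1g_2)\triangleleft h=\bigl(g_1\triangleleft(g_2\triangleright h)\bigr)(g_2\triangleleft h).$$ The bicrossed product $H\,{}_{\alpha}\!\bowtie_{\beta} G = H\bowtie G$ of the matched pair is the set $H\times G$ with the multiplication $(h_1,g_1)\cdot(h_2,g_2)=\bigl(h_1(g_1\triangleright h_2),\,(g_1\triangleleft h_2)g_2\bigr)$, which is a group with unit $(1,1)$. Equivalently, up to isomorphism, a group $E$ is a bicrossed product of $H$ and $G$ if $E$ has subgroups isomorphic to $H$ and $G$ such that every element of $E$ can be written uniquely as a product of an element of the first and an element of the second. If $G$ acts on $H$ by group automorphisms via $\alpha$, the semidirect product $H\rtimes_\alpha G$ is the set $H\times G$ with multiplication $(h_1,g_1)\cdot(h_2,g_2)=(h_1(g_1\triangleright h_2),g_1g_2)$. *)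

theory Defs
  imports "HOL-Algebra.Algebra"
begin

section \<open>Matched pairs of groups\<close>

text \<open>The library only has left actions (\<open>group_action\<close>), so right actions are spelled out.\<close>

locale right_group_action = group H for H :: "('h, 'm) monoid_scheme" (structure) +
  fixes E :: "'e set" and \<beta> :: "'e \<Rightarrow> 'h \<Rightarrow> 'e"
  assumes right_act_closed: "\<lbrakk>x \<in> E; h \<in> carrier H\<rbrakk> \<Longrightarrow> \<beta> x h \<in> E"
    and right_act_one: "x \<in> E \<Longrightarrow> \<beta> x \<one> = x"
    and right_act_mult:
      "\<lbrakk>x \<in> E; h1 \<in> carrier H; h2 \<in> carrier H\<rbrakk> \<Longrightarrow> \<beta> x (h1 \<otimes> h2) = \<beta> (\<beta> x h1) h2"

text \<open>
  \<open>\<alpha> g h\<close> is $g \triangleright h$ and \<open>\<beta> g h\<close> is $g \triangleleft h$. The library's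
  \<open>group_action\<close> demands extensional maps; restricting \<open>\<alpha> g\<close> to \<open>carrier H\<close> leaves
  the values of \<open>\<alpha>\<close> outside the carriers unconstrained, as are those of \<open>\<beta>\<close>.
\<close>

locale matched_pair =
  H: group H + G: group G +
  left: group_action G "carrier H" "\<lambda>g. restrict (\<alpha> g) (carrier H)" +
  right: right_group_action H "carrier G" \<beta>
  for H :: "('h, 'm) monoid_scheme" and G :: "('g, 'n) monoid_scheme"
    and \<alpha> :: "'g \<Rightarrow> 'h \<Rightarrow> 'h" and \<beta> :: "'g \<Rightarrow> 'h \<Rightarrow> 'g" +
  assumes left_compat:
      "\<lbrakk>g \<in> carrier G; h1 \<in> carrier H; h2 \<in> carrier H\<rbrakk>
        \<Longrightarrow> \<alpha> g (h1 \<otimes>\<^bsub>H\<^esub> h2) = \<alpha> g h1 \<otimes>\<^bsub>H\<^esub> \<alpha> (\<beta> g h1) h2"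
    and right_compat:
      "\<lbrakk>g1 \<in> carrier G; g2 \<in> carrier G; h \<in> carrier H\<rbrakk>
        \<Longrightarrow> \<beta> (g1 \<otimes>\<^bsub>G\<^esub> g2) h = \<beta> g1 (\<alpha> g2 h) \<otimes>\<^bsub>G\<^esub> \<beta> g2 h"

definition bicrossed_product ::
    "('h, 'm) monoid_scheme \<Rightarrow> ('g, 'n) monoid_scheme
      \<Rightarrow> ('g \<Rightarrow> 'h \<Rightarrow> 'h) \<Rightarrow> ('g \<Rightarrow> 'h \<Rightarrow> 'g) \<Rightarrow> ('h \<times> 'g) monoid"
  where "bicrossed_product H G \<alpha> \<beta> =
    \<lparr>carrier = carrier H \<times> carrier G,
     monoid.mult = (\<lambda>(h1, g1) (h2, g2). (h1 \<otimes>\<^bsub>H\<^esub> \<alpha> g1 h2, \<beta> g1 h2 \<otimes>\<^bsub>G\<^esub> g2)),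
     monoid.one = (\<one>\<^bsub>H\<^esub>, \<one>\<^bsub>G\<^esub>)\<rparr>"

text \<open>
  The normal factor comes first. The intended \<open>\<alpha>\<close> are the elements of
  \<open>hom G (AutoGroup H)\<close>, i.e. the actions of \<open>G\<close> on \<open>H\<close> by group automorphisms.
\<close>

definition semidirect_product ::
    "('h, 'm) monoid_scheme \<Rightarrow> ('g, 'n) monoid_scheme
      \<Rightarrow> ('g \<Rightarrow> 'h \<Rightarrow> 'h) \<Rightarrow> ('h \<times> 'g) monoid"
  where "semidirect_product H G \<alpha> =
    \<lparr>carrier = carrier H \<times> carrier G,
     monoid.mult = (\<lambda>(h1, g1) (h2, g2). (h1 \<otimes>\<^bsub>H\<^esub> \<alpha> g1 h2, g1 \<otimes>\<^bsub>G\<^esub> g2)),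
     monoid.one = (\<one>\<^bsub>H\<^esub>, \<one>\<^bsub>G\<^esub>)\<rparr>"

context matched_pair
begin

lemma left_act_closed:
  assumes "g \<in> carrier G" "h \<in> carrier H"
  shows "\<alpha> g h \<in> carrier H"
  using left.element_image[OF assms] assms by simp

lemma left_act_one:
  assumes "h \<in> carrier H"
  shows "\<alpha> \<one>\<^bsub>G\<^esub> h = h"
  using fun_cong[OF left.id_eq_one, of h] assms by simp

lemma left_act_mult:
  assumes "g1 \<in> carrier G" "g2 \<in> carrier G" "h \<in> carrier H"
  shows "\<alpha> (g1 \<otimes>\<^bsub>G\<^esub> g2) h = \<alpha> g1 (\<alpha> g2 h)"
  using left.composition_rule[of h g1 g2] assms left_act_closed by simp

lemma left_act_unit:
  assumes g: "g \<in> carrier G"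
  shows "\<alpha> g \<one>\<^bsub>H\<^esub> = \<one>\<^bsub>H\<^esub>"
proof -
  have "\<alpha> g \<one>\<^bsub>H\<^esub> = \<alpha> g \<one>\<^bsub>H\<^esub> \<otimes>\<^bsub>H\<^esub> \<alpha> g \<one>\<^bsub>H\<^esub>"
    using left_compat[of g "\<one>\<^bsub>H\<^esub>" "\<one>\<^bsub>H\<^esub>"] g right.right_act_one by simp
  then show ?thesis
    using left_act_closed[OF g H.one_closed] H.l_cancel_one by metis
qed

lemma right_act_unit:
  assumes h: "h \<in> carrier H"
  shows "\<beta> \<one>\<^bsub>G\<^esub> h = \<one>\<^bsub>G\<^esub>"
proof -
  have "\<beta> \<one>\<^bsub>G\<^esub> h = \<beta> \<one>\<^bsub>G\<^esub> h \<otimes>\<^bsub>G\<^esub> \<beta> \<one>\<^bsub>G\<^esub> h"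
    using right_compat[of "\<one>\<^bsub>G\<^esub>" "\<one>\<^bsub>G\<^esub>" h] h left_act_one by simp
  then show ?thesis
    using right.right_act_closed[OF G.one_closed h] G.l_cancel_one by metis
qed

lemma bicrossed_product_group: "group (bicrossed_product H G \<alpha> \<beta>)"
proof (rule groupI)
  show "\<one>\<^bsub>bicrossed_product H G \<alpha> \<beta>\<^esub> \<in> carrier (bicrossed_product H G \<alpha> \<beta>)"
    by (simp add: bicrossed_product_def)
next
  fix x y
  assume "x \<in> carrier (bicrossed_product H G \<alpha> \<beta>)" "y \<in> carrier (bicrossed_product H G \<alpha> \<beta>)"
  then show "x \<otimes>\<^bsub>bicrossed_product H G \<alpha> \<beta>\<^esub> y \<in> carrier (bicrossed_product H G \<alpha> \<beta>)"
    by (auto simp: bicrossed_product_def left_act_closed right.right_act_closed)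
next
  fix x y z
  assume "x \<in> carrier (bicrossed_product H G \<alpha> \<beta>)" "y \<in> carrier (bicrossed_product H G \<alpha> \<beta>)"
    "z \<in> carrier (bicrossed_product H G \<alpha> \<beta>)"
  then show "x \<otimes>\<^bsub>bicrossed_product H G \<alpha> \<beta>\<^esub> y \<otimes>\<^bsub>bicrossed_product H G \<alpha> \<beta>\<^esub> z
      = x \<otimes>\<^bsub>bicrossed_product H G \<alpha> \<beta>\<^esub> (y \<otimes>\<^bsub>bicrossed_product H G \<alpha> \<beta>\<^esub> z)"
    by (auto simp: bicrossed_product_def left_act_closed right.right_act_closed
        H.m_assoc G.m_assoc left_act_mult right.right_act_mult left_compat right_compat)
next
  fix x
  assume "x \<in> carrier (bicrossed_product H G \<alpha> \<beta>)"
  then show "\<one>\<^bsub>bicrossed_product H G \<alpha> \<beta>\<^esub> \<otimes>\<^bsub>bicrossed_product H G \<alpha> \<beta>\<^esub> x = x"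
    by (auto simp: bicrossed_product_def left_act_one right_act_unit)
next
  fix x
  assume "x \<in> carrier (bicrossed_product H G \<alpha> \<beta>)"
  then obtain h g where x: "x = (h, g)" and h: "h \<in> carrier H" and g: "g \<in> carrier G"
    by (auto simp: bicrossed_product_def)
  let ?g = "\<beta> (inv\<^bsub>G\<^esub> g) (inv\<^bsub>H\<^esub> h)"
  have g': "?g \<in> carrier G" "\<beta> ?g h = inv\<^bsub>G\<^esub> g"
    using h g right.right_act_mult[of "inv\<^bsub>G\<^esub> g" "inv\<^bsub>H\<^esub> h" h]
    by (simp_all add: right.right_act_closed right.right_act_one)
  then have "(inv\<^bsub>H\<^esub> \<alpha> ?g h, ?g) \<in> carrier (bicrossed_product H G \<alpha> \<beta>)"
    "(inv\<^bsub>H\<^esub> \<alpha> ?g h, ?g) \<otimes>\<^bsub>bicrossed_product H G \<alpha> \<beta>\<^esub> x = \<one>\<^bsub>bicrossed_product H G \<alpha> \<beta>\<^esub>"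
    using h g by (simp_all add: x bicrossed_product_def left_act_closed)
  then show "\<exists>y\<in>carrier (bicrossed_product H G \<alpha> \<beta>).
      y \<otimes>\<^bsub>bicrossed_product H G \<alpha> \<beta>\<^esub> x = \<one>\<^bsub>bicrossed_product H G \<alpha> \<beta>\<^esub>"
    by blast
qed

end

end

(*
  Let E = PK with P of prime order p, K abelian and P, K meeting trivially; suppose K is not
  normal. As K has prime index it is maximal, so the centralizer of an element of K is K or E;
  hence the centre Z lies in K, and distinct conjugates of K meet exactly in Z. The elements
  without a conjugate in K - Z number |E| - p(|K| - |Z|) = p|Z|, so they form A = PZ, which is
  therefore an abelian normal subgroup. For g in K - Z the commutator map a -> [g, a] is an
  endomorphism of A with kernel Z; it embeds P onto a subgroup B that is normal in E and meets K
  trivially, so E is the semidirect product of B (isomorphic to P) by K. If K is normal, E is the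
  semidirect product of K by P. A bicrossed product of cyclic groups is such an E, with the factor
  of order p in either position.
*)

theory Submission
  imports Defs
begin

section \<open>Centralizers, subgroups of prime index, and complements in a group\<close>

context group
begin

lemma inv_mult_cancel:
  assumes "x \<in> carrier G" "y \<in> carrier G"
  shows "x \<otimes> (inv x \<otimes> y) = y" "inv x \<otimes> (x \<otimes> y) = y"
  using assms by (simp_all flip: m_assoc)

text \<open>As simplification rules these bring group words to right-associated form and cancel
  neighbouring inverses, also in front of a tail.\<close>

lemmas group_word = m_assoc inv_mult_group inv_mult_cancel

text \<open>This is the centralizer of \<open>x\<close>. It serves as the intermediate subgroup in
  the maximality argument, and membership in it expresses that commuting is preserved by products
  and inverses.\<close>

lemma subgroup_commute_with:
  assumes x: "x \<in> carrier G"
  shows "subgroup {y \<in> carrier G. y \<otimes> x = x \<otimes> y} G"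
proof (rule subgroupI)
  fix a assume a: "a \<in> {y \<in> carrier G. y \<otimes> x = x \<otimes> y}"
  then have c: "a \<in> carrier G" by simp
  have "inv a \<otimes> x = inv a \<otimes> (x \<otimes> a) \<otimes> inv a" using c x by (simp add: m_assoc)
  also have "\<dots> = inv a \<otimes> (a \<otimes> x) \<otimes> inv a" using a by simp
  also have "\<dots> = x \<otimes> inv a" using c x by (simp add: group_word)
  finally show "inv a \<in> {y \<in> carrier G. y \<otimes> x = x \<otimes> y}" using c by simp
next
  fix a b assume "a \<in> {y \<in> carrier G. y \<otimes> x = x \<otimes> y}" "b \<in> {y \<in> carrier G. y \<otimes> x = x \<otimes> y}"
  then show "a \<otimes> b \<in> {y \<in> carrier G. y \<otimes> x = x \<otimes> y}"
    using x by (auto simp: m_assoc) (simp flip: m_assoc)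
qed (use x in auto)

lemma commute_mult:
  assumes "a \<in> carrier G" "b \<in> carrier G" "x \<in> carrier G"
    and "a \<otimes> x = x \<otimes> a" "b \<otimes> x = x \<otimes> b"
  shows "(a \<otimes> b) \<otimes> x = x \<otimes> (a \<otimes> b)"
  using subgroup.m_closed[OF subgroup_commute_with[OF assms(3)], of a b] assms by blast

text \<open>Lagrange, applied to \<open>K\<close> in \<open>L\<close> and to \<open>L\<close> in the
  group, writes \<open>p\<close> as the product of the two indices \<open>s\<close> and
  \<open>r\<close>; primality makes one of them 1.\<close>

lemma prime_index_maximal:
  assumes fin: "finite (carrier G)" and K: "subgroup K G" and L: "subgroup L G" and KL: "K \<subseteq> L"
    and p: "Factorial_Ring.prime (p::nat)" and ord: "order G = p * card K"
  shows "L = K \<or> L = carrier G"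
proof -
  have LG: "L \<subseteq> carrier G" using L by (rule subgroup.subset)
  then have finL: "finite L" and finK: "finite K" using fin KL by (auto intro: finite_subset)
  interpret L: group "G\<lparr>carrier := L\<rparr>" using L by (rule subgroup_imp_group)
  have "subgroup K (G\<lparr>carrier := L\<rparr>)" using subgroup_incl[OF K L KL] .
  then have "\<exists>r. card L = r * card K"
    using L.lagrange by (intro exI[of _ "card (rcosets\<^bsub>G\<lparr>carrier := L\<rparr>\<^esub> K)"]) (simp add: order_def)
  then obtain r where r: "card L = r * card K" ..
  from lagrange[OF L] obtain s where s: "order G = s * card L" by metis
  have "card K > 0" using finK K subgroup.one_closed by (fastforce simp: card_gt_0_iff)
  then have "p = s * r" using r s ord by simp
  then have "s = 1 \<or> r = 1" using p by (metis prime_product)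
  then show ?thesis
    using r s fin finL KL LG card_subset_eq[of L K] card_subset_eq[OF fin LG]
    by (metis card_subset_eq mult_1 order_def)
qed

text \<open>An equality of two products rearranges to
  \<open>inv c \<otimes> a = d \<otimes> inv b\<close>, an element of both \<open>P\<close> and
  \<open>K\<close>.\<close>

lemma mult_inj_on_Times:
  assumes P: "subgroup P G" and K: "subgroup K G" and triv: "P \<inter> K = {\<one>}"
  shows "inj_on (\<lambda>(a, b). a \<otimes> b) (P \<times> K)"
proof (rule inj_onI, clarify)
  fix a b c d assume *: "a \<in> P" "b \<in> K" "c \<in> P" "d \<in> K" "a \<otimes> b = c \<otimes> d"
  have c: "a \<in> carrier G" "b \<in> carrier G" "c \<in> carrier G" "d \<in> carrier G"
    using * P K subgroup.mem_carrier by metis+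
  have "inv c \<otimes> (a \<otimes> b) \<otimes> inv b = inv c \<otimes> (c \<otimes> d) \<otimes> inv b" using * by simp
  then have e: "inv c \<otimes> a = d \<otimes> inv b" using c by (simp add: group_word)
  have "inv c \<otimes> a \<in> P" using * P by (simp add: subgroup.m_inv_closed subgroup.m_closed)
  moreover have "d \<otimes> inv b \<in> K" using * K by (simp add: subgroup.m_inv_closed subgroup.m_closed)
  ultimately have "inv c \<otimes> a = \<one>" "d \<otimes> inv b = \<one>" using e triv by auto
  then show "a = c \<and> b = d"
    using c by (metis inv_closed inv_equality inv_inv)
qed

text \<open>By injectivity there are as many products as the finite group has elements.\<close>

lemma complement_factor:
  assumes P: "subgroup P G" and K: "subgroup K G" and triv: "P \<inter> K = {\<one>}"
    and fin: "finite (carrier G)" and ord: "order G = card P * card K"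
  shows "(\<lambda>(a, b). a \<otimes> b) ` (P \<times> K) = carrier G"
proof (rule card_subset_eq[OF fin])
  show "(\<lambda>(a, b). a \<otimes> b) ` (P \<times> K) \<subseteq> carrier G"
    using P K subgroup.mem_carrier by fastforce
  show "card ((\<lambda>(a, b). a \<otimes> b) ` (P \<times> K)) = card (carrier G)"
    using card_image[OF mult_inj_on_Times[OF P K triv]] ord
    by (simp add: card_cartesian_product order_def)
qed

end

section \<open>An abelian complement that is not normal\<close>

locale non_normal_complement = group G for G (structure) +
  fixes P K :: "'a set" and p :: nat
  assumes fin: "finite (carrier G)"
    and P: "subgroup P G" and K: "subgroup K G"
    and P_comm: "\<lbrakk>x \<in> P; y \<in> P\<rbrakk> \<Longrightarrow> x \<otimes> y = y \<otimes> x"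
    and K_comm: "\<lbrakk>x \<in> K; y \<in> K\<rbrakk> \<Longrightarrow> x \<otimes> y = y \<otimes> x"
    and triv: "P \<inter> K = {\<one>}"
    and p: "Factorial_Ring.prime p" and cardP: "card P = p" and ord: "order G = p * card K"
    and not_normal: "\<not> K \<lhd> G"
begin

lemma P_carrier: "x \<in> P \<Longrightarrow> x \<in> carrier G" using P by (rule subgroup.mem_carrier)
lemma K_carrier: "x \<in> K \<Longrightarrow> x \<in> carrier G" using K by (rule subgroup.mem_carrier)

lemma factor_PK:
  assumes "x \<in> carrier G" obtains a b where "a \<in> P" "b \<in> K" "x = a \<otimes> b"
proof -
  have "x \<in> (\<lambda>(a, b). a \<otimes> b) ` (P \<times> K)"
    using complement_factor[OF P K triv fin] ord cardP assms by blast
  then show ?thesis using that by auto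
qed

text \<open>Inverting the other factorization reverses its order. In this form a conjugation by
  \<open>x\<close> acts first by an element of \<open>P\<close>, then by one of
  \<open>K\<close>.\<close>

lemma factor_KP:
  assumes x: "x \<in> carrier G" obtains a b where "a \<in> P" "b \<in> K" "x = b \<otimes> a"
proof -
  obtain a b where ab: "a \<in> P" "b \<in> K" "inv x = a \<otimes> b" using x factor_PK[of "inv x"] by auto
  then have "x = inv b \<otimes> inv a"
    using x P_carrier K_carrier by (metis inv_inv inv_mult_group)
  then show ?thesis using that[of "inv a" "inv b"] ab P K subgroup.m_inv_closed by metis
qed

section \<open>The centre and the conjugates of \<open>K\<close>\<close>

definition Z where "Z = {z \<in> carrier G. \<forall>x\<in>carrier G. x \<otimes> z = z \<otimes> x}"

lemma Z_carrier: "z \<in> Z \<Longrightarrow> z \<in> carrier G"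
  by (simp add: Z_def)

lemma Z_commute: "\<lbrakk>z \<in> Z; x \<in> carrier G\<rbrakk> \<Longrightarrow> z \<otimes> x = x \<otimes> z"
  by (simp add: Z_def)

lemma ZI: "\<lbrakk>z \<in> carrier G; \<And>x. x \<in> carrier G \<Longrightarrow> z \<otimes> x = x \<otimes> z\<rbrakk> \<Longrightarrow> z \<in> Z"
  unfolding Z_def by simp

lemma Z_conj:
  assumes "z \<in> Z" "x \<in> carrier G"
  shows "x \<otimes> z \<otimes> inv x = z"
proof -
  have "x \<otimes> z \<otimes> inv x = z \<otimes> x \<otimes> inv x" using Z_commute[OF assms] by simp
  then show ?thesis using Z_carrier[OF assms(1)] assms(2) by (simp add: m_assoc)
qed

text \<open>Conjugation fixes central elements, so a central \<open>K\<close> would be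
  normal.\<close>

lemma K_not_subset_Z: "\<exists>k\<in>K. k \<notin> Z"
  using not_normal K Z_conj unfolding normal_inv_iff by fastforce

lemma Z_subgroup: "subgroup Z G"
proof (rule subgroupI)
  fix a assume a: "a \<in> Z"
  then have "a \<in> {y \<in> carrier G. y \<otimes> x = x \<otimes> y}" if "x \<in> carrier G" for x
    using Z_carrier Z_commute that by blast
  then have "inv a \<in> {y \<in> carrier G. y \<otimes> x = x \<otimes> y}" if "x \<in> carrier G" for x
    using subgroup.m_inv_closed[OF subgroup_commute_with[OF that]] that by blast
  then show "inv a \<in> Z" using Z_carrier[OF a] by (intro ZI) blast+
next
  fix a b assume ab: "a \<in> Z" "b \<in> Z"
  note c = Z_carrier[OF ab(1)] Z_carrier[OF ab(2)]
  show "a \<otimes> b \<in> Z"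
    by (rule ZI[OF m_closed[OF c] commute_mult[OF c]])
      (use Z_commute[OF ab(1)] Z_commute[OF ab(2)] in blast)+
next
  have "\<one> \<in> Z" by (rule ZI) auto
  then show "Z \<noteq> {}" by blast
qed (use Z_carrier in blast)

text \<open>The centralizer of \<open>k\<close> contains the abelian group \<open>K\<close> and also
  \<open>x\<close>, which lies outside it; by maximality it is everything.\<close>

lemma central_if_commutes_outside:
  assumes k: "k \<in> K" and x: "x \<in> carrier G" "x \<notin> K" and c: "x \<otimes> k = k \<otimes> x"
  shows "k \<in> Z"
proof -
  let ?L = "{y \<in> carrier G. y \<otimes> k = k \<otimes> y}"
  have "?L = K \<or> ?L = carrier G"
    by (rule prime_index_maximal[OF fin K subgroup_commute_with _ p ord])
      (use k K_comm K_carrier in auto)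
  then show ?thesis
  proof
    assume "?L = K"
    then show ?thesis using x c by blast
  next
    assume "?L = carrier G"
    then have "k \<otimes> y = y \<otimes> k" if "y \<in> carrier G" for y using that by force
    then show ?thesis using ZI K_carrier[OF k] by blast
  qed
qed

text \<open>A central element outside \<open>K\<close> would commute with a noncentral element of
  \<open>K\<close>, against \<open>central_if_commutes_outside\<close>.\<close>

lemma Z_subset_K: "Z \<subseteq> K"
proof
  fix z assume z: "z \<in> Z"
  obtain k where k: "k \<in> K" "k \<notin> Z" using K_not_subset_Z by blast
  then show "z \<in> K"
    using central_if_commutes_outside[OF k(1) Z_carrier[OF z]] Z_commute[OF z K_carrier] by blast
qed

text \<open>By maximality the normalizer of the non-normal \<open>K\<close> is \<open>K\<close>
  itself, so \<open>x\<close> moves some \<open>y\<close> in \<open>K\<close> out of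
  \<open>K\<close>. Since \<open>y\<close> commutes with the conjugate of \<open>k\<close>, the
  element \<open>k\<close> commutes with \<open>inv x \<otimes> y \<otimes> x\<close>, which is
  outside \<open>K\<close>.\<close>

lemma central_if_conjugate:
  assumes k: "k \<in> K" and x: "x \<in> carrier G" "x \<notin> K" and c: "x \<otimes> k \<otimes> inv x \<in> K"
  shows "k \<in> Z"
proof -
  have "\<exists>y\<in>K. inv x \<otimes> y \<otimes> x \<notin> K"
  proof (rule ccontr)
    assume "\<not> (\<exists>y\<in>K. inv x \<otimes> y \<otimes> x \<notin> K)"
    then have sub: "(\<lambda>y. inv x \<otimes> y \<otimes> x) ` K \<subseteq> K" by auto
    have inj: "inj_on (\<lambda>y. inv x \<otimes> y \<otimes> x) (carrier G)"
      using x by (auto intro!: inj_onI)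
    \<comment> \<open>Finiteness turns the inclusion into an equality; this gives the converse
      implication when \<open>x\<close> is tested for membership in \<open>?N\<close>.\<close>
    have "finite K" using fin K subgroup.subset finite_subset by blast
    then have img: "(\<lambda>y. inv x \<otimes> y \<otimes> x) ` K = K"
      by (rule endo_inj_surj[OF _ sub]) (use inj K_carrier in \<open>auto intro: inj_on_subset\<close>)
    \<comment> \<open>The normalizer of \<open>K\<close>, stated as an equivalence so that closure
      under inverses follows by substituting a conjugate for \<open>y\<close>.\<close>
    let ?N = "{x \<in> carrier G. \<forall>y\<in>carrier G. y \<in> K \<longleftrightarrow> inv x \<otimes> y \<otimes> x \<in> K}"
    have N_D: "a \<in> carrier G" "y \<in> carrier G \<Longrightarrow> inv a \<otimes> y \<otimes> a \<in> K \<longleftrightarrow> y \<in> K"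
      if "a \<in> ?N" for a y
      using that by blast+
    have N: "subgroup ?N G"
    proof (rule subgroupI)
      fix a assume a: "a \<in> ?N"
      have "y \<in> K \<longleftrightarrow> inv (inv a) \<otimes> y \<otimes> inv a \<in> K" if y: "y \<in> carrier G" for y
        using N_D(2)[OF a, of "a \<otimes> y \<otimes> inv a"] N_D(1)[OF a] y by (simp add: group_word)
      then show "inv a \<in> ?N" using N_D(1)[OF a] by blast
    next
      fix a b assume a: "a \<in> ?N" and b: "b \<in> ?N"
      have "y \<in> K \<longleftrightarrow> inv (a \<otimes> b) \<otimes> y \<otimes> (a \<otimes> b) \<in> K" if y: "y \<in> carrier G" for y
        using N_D(2)[OF a y] N_D(2)[OF b, of "inv a \<otimes> y \<otimes> a"] N_D(1)[OF a] N_D(1)[OF b] y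
        by (simp add: group_word)
      then show "a \<otimes> b \<in> ?N" using N_D(1)[OF a] N_D(1)[OF b] by blast
    next
      have "\<one> \<in> ?N" by simp
      then show "?N \<noteq> {}" by blast
    qed blast
    have "K \<subseteq> ?N"
    proof
      fix a assume a: "a \<in> K"
      have "y \<in> K" if y: "y \<in> carrier G" "inv a \<otimes> y \<otimes> a \<in> K" for y
      proof -
        have "a \<otimes> (inv a \<otimes> y \<otimes> a) \<otimes> inv a \<in> K"
          using subgroup.m_closed[OF K subgroup.m_closed[OF K a y(2)] subgroup.m_inv_closed[OF K a]] .
        then show ?thesis using K_carrier[OF a] y(1) by (simp add: group_word)
      qed
      moreover have "inv a \<otimes> y \<otimes> a \<in> K" if "y \<in> K" for y
        using K a that by (intro subgroup.m_closed subgroup.m_inv_closed)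
      ultimately show "a \<in> ?N" using K_carrier[OF a] by blast
    qed
    moreover have "x \<in> ?N"
    proof -
      have "y \<in> K" if y: "y \<in> carrier G" "inv x \<otimes> y \<otimes> x \<in> K" for y
      proof -
        have "inv x \<otimes> y \<otimes> x \<in> (\<lambda>y. inv x \<otimes> y \<otimes> x) ` K" using y(2) unfolding img .
        then obtain k where "k \<in> K" "inv x \<otimes> y \<otimes> x = inv x \<otimes> k \<otimes> x" by blast
        then show ?thesis using inj_onD[OF inj, of y k] y(1) K_carrier by metis
      qed
      then show ?thesis using x(1) sub by blast
    qed
    ultimately have "?N = carrier G"
      using prime_index_maximal[OF fin K N _ p ord] x by blast
    then have "x \<otimes> y \<otimes> inv x \<in> K" if "y \<in> K" "x \<in> carrier G" for x y
      using N_D(2)[of "inv x" y] that K_carrier by (metis inv_closed inv_inv)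
    then show False using not_normal K normal_inv_iff by auto
  qed
  then obtain y where y: "y \<in> K" "inv x \<otimes> y \<otimes> x \<notin> K" by auto
  show ?thesis
  proof (rule central_if_commutes_outside[OF k _ y(2)])
    show "inv x \<otimes> y \<otimes> x \<in> carrier G" using x y K_carrier by simp
    \<comment> \<open>Conjugating a commutation relation inside \<open>K\<close> by
      \<open>inv x\<close> yields one for \<open>k\<close>.\<close>
    have "inv x \<otimes> (y \<otimes> (x \<otimes> k \<otimes> inv x)) \<otimes> x = inv x \<otimes> ((x \<otimes> k \<otimes> inv x) \<otimes> y) \<otimes> x"
      using K_comm[OF y(1) c] by simp
    then show "inv x \<otimes> y \<otimes> x \<otimes> k = k \<otimes> (inv x \<otimes> y \<otimes> x)"
      using x y k K_carrier by (simp add: group_word)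
  qed
qed

section \<open>Elements having no conjugate in \<open>K - Z\<close>\<close>

definition A where "A = {a \<in> carrier G. \<forall>x\<in>carrier G. x \<otimes> a \<otimes> inv x \<in> K \<longrightarrow> a \<in> Z}"

text \<open>The definition of \<open>A\<close> quantifies over all conjugates, and conjugation fixes
  \<open>Z\<close> pointwise. Invariance thus comes before \<open>A\<close> is known to be closed
  under products.\<close>

lemma A_conj:
  assumes a: "a \<in> A" and x: "x \<in> carrier G"
  shows "x \<otimes> a \<otimes> inv x \<in> A"
proof -
  have "x \<otimes> a \<otimes> inv x \<in> Z"
    if "y \<in> carrier G" "y \<otimes> (x \<otimes> a \<otimes> inv x) \<otimes> inv y \<in> K" for y
  proof -
    have "(y \<otimes> x) \<otimes> a \<otimes> inv (y \<otimes> x) \<in> K" using that a x by (simp add: group_word A_def)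
    then have "a \<in> Z" using a that x unfolding A_def by blast
    then show ?thesis using x by (simp add: Z_conj)
  qed
  then show ?thesis using a x unfolding A_def by blast
qed

lemma A_Int_K: "a \<in> A \<Longrightarrow> a \<in> K \<Longrightarrow> a \<in> Z"
  unfolding A_def using K_carrier by (auto dest!: bspec[of _ _ \<one>])

text \<open>For a conjugator \<open>b \<otimes> a\<close> with \<open>b\<close> in \<open>K\<close>
  and \<open>a\<close> in \<open>P\<close>, the contributions of \<open>b\<close> and
  \<open>z\<close> can be stripped off inside \<open>K\<close>. What remains is the conjugate of
  \<open>h\<close> by \<open>a\<close>, which is \<open>h\<close> as \<open>P\<close> is abelian; so
  \<open>h\<close> lies in \<open>P \<inter> K\<close>.\<close>

lemma PZ_subset_A: "(\<lambda>(a, b). a \<otimes> b) ` (P \<times> Z) \<subseteq> A"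
proof clarify
  fix h z assume h: "h \<in> P" and z: "z \<in> Z"
  have zc: "z \<in> carrier G" using z by (rule Z_carrier)
  have "h \<otimes> z \<in> Z" if x: "x \<in> carrier G" "x \<otimes> (h \<otimes> z) \<otimes> inv x \<in> K" for x
  proof -
    obtain a b where ab: "a \<in> P" "b \<in> K" "x = b \<otimes> a" using x factor_KP by metis
    note c = P_carrier[OF h] P_carrier[OF ab(1)] K_carrier[OF ab(2)] zc
    have "inv b \<otimes> (x \<otimes> (h \<otimes> z) \<otimes> inv x) \<otimes> b \<otimes> inv z \<in> K"
      using subgroup.m_closed[OF K subgroup.m_closed[OF K subgroup.m_closed[OF K _ x(2)]]]
        subgroup.m_inv_closed[OF K] ab z Z_subset_K by blast
    also have "inv b \<otimes> (x \<otimes> (h \<otimes> z) \<otimes> inv x) \<otimes> b \<otimes> inv z = a \<otimes> h \<otimes> (z \<otimes> inv a) \<otimes> inv z"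
      using c ab by (simp add: group_word)
    also have "z \<otimes> inv a = inv a \<otimes> z" using Z_commute[OF z] c by simp
    also have "a \<otimes> h \<otimes> (inv a \<otimes> z) \<otimes> inv z = a \<otimes> h \<otimes> inv a" using c by (simp add: group_word)
    finally have "a \<otimes> h \<otimes> inv a \<in> K" .
    moreover have "a \<otimes> h \<otimes> inv a = h"
      using P_comm[OF ab(1) h] c by (simp add: m_assoc)
    ultimately have "h = \<one>" using h triv by auto
    then show ?thesis using z zc by simp
  qed
  then show "h \<otimes> z \<in> A" using P_carrier[OF h] zc by (auto simp: A_def)
qed

text \<open>One inclusion is known, so it remains to bound \<open>card A\<close> by
  \<open>p * card Z\<close>. This is done by counting enough elements outside
  \<open>A\<close>.\<close>

lemma A_eq: "A = (\<lambda>(a, b). a \<otimes> b) ` (P \<times> Z)"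
proof (rule sym, rule card_seteq[OF _ PZ_subset_A])
  have AG: "A \<subseteq> carrier G" by (auto simp: A_def)
  then show "finite A" using fin finite_subset by blast
  have finK: "finite K" using fin K subgroup.subset finite_subset by blast
  \<comment> \<open>The conjugates of \<open>K - Z\<close> by the \<open>p\<close> elements of
    \<open>P\<close> are pairwise disjoint and avoid \<open>A\<close>; injectivity of
    \<open>?F\<close> encodes the disjointness.\<close>
  let ?F = "\<lambda>(h, k). h \<otimes> k \<otimes> inv h"
  have "inj_on ?F (P \<times> (K - Z))"
  proof (rule inj_onI, clarify)
    fix h k h' k'
    assume *: "h \<in> P" "k \<in> K" "k \<notin> Z" "h' \<in> P" "k' \<in> K" "k' \<notin> Z"
      and eq: "h \<otimes> k \<otimes> inv h = h' \<otimes> k' \<otimes> inv h'"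
    note c = P_carrier[OF \<open>h \<in> P\<close>] P_carrier[OF \<open>h' \<in> P\<close>] K_carrier[OF \<open>k \<in> K\<close>] K_carrier[OF \<open>k' \<in> K\<close>]
    have "inv h' \<otimes> (h \<otimes> k \<otimes> inv h) \<otimes> h' = inv h' \<otimes> (h' \<otimes> k' \<otimes> inv h') \<otimes> h'"
      using eq by simp
    then have "(inv h' \<otimes> h) \<otimes> k \<otimes> inv (inv h' \<otimes> h) = k'" using c by (simp add: group_word)
    \<comment> \<open>Otherwise \<open>central_if_conjugate\<close> would put \<open>k\<close> into
      \<open>Z\<close>.\<close>
    then have "inv h' \<otimes> h \<in> K"
      using central_if_conjugate[of k "inv h' \<otimes> h"] c * by auto
    moreover have "inv h' \<otimes> h \<in> P" using * P by (simp add: subgroup.m_closed subgroup.m_inv_closed)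
    ultimately have "inv h' \<otimes> h = \<one>" using triv by auto
    then have "h = h'" using c by (metis inv_closed inv_equality inv_inv)
    then show "h = h' \<and> k = k'" using eq c by simp
  qed
  then have "card (?F ` (P \<times> (K - Z))) = p * (card K - card Z)"
    using cardP Z_subset_K finK
    by (simp add: card_image card_cartesian_product card_Diff_subset finite_subset)
  moreover have "?F ` (P \<times> (K - Z)) \<subseteq> carrier G - A"
  proof clarify
    fix h k assume *: "h \<in> P" "k \<in> K" "k \<notin> Z"
    note c = P_carrier[OF \<open>h \<in> P\<close>] K_carrier[OF \<open>k \<in> K\<close>]
    have "inv h \<otimes> (h \<otimes> k \<otimes> inv h) \<otimes> inv (inv h) = k" using c by (simp add: group_word)
    then have "h \<otimes> k \<otimes> inv h \<notin> A"
      using A_conj[of "h \<otimes> k \<otimes> inv h" "inv h"] A_Int_K[of k] * c by auto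
    then show "h \<otimes> k \<otimes> inv h \<in> carrier G - A" using c by auto
  qed
  then have "card (?F ` (P \<times> (K - Z))) \<le> card (carrier G - A)"
    using fin by (intro card_mono) auto
  moreover have "card (carrier G - A) = p * card K - card A"
    using ord AG fin by (simp add: card_Diff_subset finite_subset order_def)
  \<comment> \<open>Subtraction of natural numbers truncates, so this bound is required before the
    two differences can be compared.\<close>
  moreover have "card A \<le> p * card K"
    using ord AG fin card_mono by (metis order_def)
  moreover have "p * card Z \<le> p * card K" using card_mono[OF finK Z_subset_K] by simp
  ultimately have "card A \<le> p * card Z" by (simp add: right_diff_distrib')
  also have "p * card Z = card ((\<lambda>(a, b). a \<otimes> b) ` (P \<times> Z))"
  proof -
    have "inj_on (\<lambda>(a, b). a \<otimes> b) (P \<times> Z)"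
      using mult_inj_on_Times[OF P K triv] by (rule inj_on_subset) (use Z_subset_K in auto)
    then show ?thesis using cardP by (simp add: card_image card_cartesian_product)
  qed
  finally show "card A \<le> card ((\<lambda>(a, b). a \<otimes> b) ` (P \<times> Z))" .
qed

section \<open>The abelian group \<open>A\<close> and the commutator map on it\<close>

lemma A_factor:
  assumes "a \<in> A" obtains h z where "h \<in> P" "z \<in> Z" "a = h \<otimes> z"
proof -
  obtain q where "a = (\<lambda>(a, b). a \<otimes> b) q" "q \<in> P \<times> Z"
    using assms unfolding A_eq by (rule imageE)
  then show ?thesis using that[of "fst q" "snd q"] by (simp add: case_prod_beta mem_Times_iff)
qed

lemma A_factorI:
  assumes "h \<in> P" "z \<in> Z" shows "h \<otimes> z \<in> A"
  using imageI[of "(h, z)" "P \<times> Z" "\<lambda>(a, b). a \<otimes> b"] assms unfolding A_eq by simp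

text \<open>Elements of \<open>P\<close> commute with both factors of an element of
  \<open>A\<close>, hence with all of \<open>A\<close>; then both factors of \<open>a\<close>
  commute with \<open>b\<close>.\<close>

lemma A_comm:
  assumes "a \<in> A" "b \<in> A"
  shows "a \<otimes> b = b \<otimes> a"
proof -
  have commP: "x \<otimes> a = a \<otimes> x" if x: "x \<in> P" and a: "a \<in> A" for x a
  proof -
    obtain h z where hz: "h \<in> P" "z \<in> Z" "a = h \<otimes> z" using A_factor[OF a] .
    show ?thesis
      unfolding hz(3)
      by (rule commute_mult[OF _ _ _ P_comm[OF hz(1) x] Z_commute[OF hz(2)], symmetric])
        (use hz x P_carrier Z_carrier in blast)+
  qed
  obtain h z where hz: "h \<in> P" "z \<in> Z" "a = h \<otimes> z" using A_factor[OF assms(1)] .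
  have "b \<in> carrier G" using assms by (simp add: A_def)
  then show ?thesis
    unfolding hz(3)
    by (intro commute_mult[OF _ _ _ commP[OF hz(1) assms(2)] Z_commute[OF hz(2)]])
      (use hz P_carrier Z_carrier in blast)+
qed

lemma A_mult:
  assumes a: "a \<in> A" and b: "b \<in> A"
  shows "a \<otimes> b \<in> A"
proof -
  obtain h z where hz: "h \<in> P" "z \<in> Z" "a = h \<otimes> z" using A_factor[OF a] .
  obtain h' z' where hz': "h' \<in> P" "z' \<in> Z" "b = h' \<otimes> z'" using A_factor[OF b] .
  note c = P_carrier[OF hz(1)] P_carrier[OF hz'(1)] Z_carrier[OF hz(2)] Z_carrier[OF hz'(2)]
  have "a \<otimes> b = h \<otimes> (z \<otimes> h') \<otimes> z'" using hz hz' c by (simp add: m_assoc)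
  also have "z \<otimes> h' = h' \<otimes> z" using Z_commute[OF hz(2) c(2)] .
  finally have "a \<otimes> b = (h \<otimes> h') \<otimes> (z \<otimes> z')" using c by (simp add: m_assoc)
  then show ?thesis
    using A_factorI[OF subgroup.m_closed[OF P hz(1) hz'(1)] subgroup.m_closed[OF Z_subgroup hz(2) hz'(2)]]
    by simp
qed

lemma P_subset_A: "P \<subseteq> A"
proof
  fix h assume h: "h \<in> P"
  show "h \<in> A"
    using A_factorI[OF h subgroup.one_closed[OF Z_subgroup]] r_one[OF P_carrier[OF h]] by simp
qed

lemma A_inv:
  assumes a: "a \<in> A"
  shows "inv a \<in> A"
proof -
  obtain h z where hz: "h \<in> P" "z \<in> Z" "a = h \<otimes> z" using A_factor[OF a] .
  note c = P_carrier[OF hz(1)] Z_carrier[OF hz(2)]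
  have "inv a = inv h \<otimes> inv z"
    using hz(3) c Z_commute[OF subgroup.m_inv_closed[OF Z_subgroup hz(2)], of "inv h"]
    by (simp add: inv_mult_group)
  then show ?thesis
    using A_factorI[OF subgroup.m_inv_closed[OF P hz(1)] subgroup.m_inv_closed[OF Z_subgroup hz(2)]]
    by simp
qed

text \<open>The embedding \<open>\<theta>\<close> is the commutator with a fixed noncentral
  \<open>g\<close> in \<open>K\<close>. It replaces \<open>P\<close> by a normal subgroup of the
  same order that still meets \<open>K\<close> trivially.\<close>

lemma normal_complement:
  "\<exists>\<theta>. \<theta> \<in> mon (G\<lparr>carrier := P\<rparr>) G \<and> \<theta> ` P \<lhd> G \<and> \<theta> ` P \<inter> K = {\<one>}"
proof -
  obtain g where g: "g \<in> K" "g \<notin> Z" using K_not_subset_Z by blast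
  have gc: "g \<in> carrier G" using g K_carrier by auto
  define \<theta> where "\<theta> a = g \<otimes> a \<otimes> inv g \<otimes> inv a" for a
  have Ac: "a \<in> carrier G" if "a \<in> A" for a using that by (simp add: A_def)
  have \<theta>A: "\<theta> a \<in> A" if "a \<in> A" for a
    unfolding \<theta>_def using that A_conj A_mult A_inv gc by simp
  \<comment> \<open>The commutator map is multiplicative because \<open>\<theta> b\<close> and
    \<open>inv a\<close> both lie in the abelian group \<open>A\<close> and can be
    interchanged.\<close>
  have \<theta>_mult: "\<theta> (a \<otimes> b) = \<theta> a \<otimes> \<theta> b" if a: "a \<in> A" and b: "b \<in> A" for a b
  proof -
    note c = Ac[OF a] Ac[OF b] gc
    have "\<theta> (a \<otimes> b) = (g \<otimes> a \<otimes> inv g) \<otimes> (\<theta> b \<otimes> inv a)"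
      using c by (simp add: \<theta>_def group_word)
    also have "\<theta> b \<otimes> inv a = inv a \<otimes> \<theta> b" using A_comm \<theta>A A_inv a b by blast
    finally show ?thesis using c Ac[OF \<theta>A[OF b]] by (simp add: \<theta>_def group_word)
  qed
  \<comment> \<open>Since \<open>\<theta>\<close> kills the central factor, its values on
    \<open>A\<close> are already taken on \<open>P\<close>.\<close>
  have \<theta>P: "\<exists>h\<in>P. \<theta> a = \<theta> h" if a: "a \<in> A" for a
  proof -
    obtain h z where hz: "h \<in> P" "z \<in> Z" "a = h \<otimes> z" using A_factor[OF a] .
    note c = P_carrier[OF hz(1)] Z_carrier[OF hz(2)]
    have "\<theta> z = (z \<otimes> g) \<otimes> inv g \<otimes> inv z"
      unfolding \<theta>_def Z_commute[OF hz(2) gc] ..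
    then have \<theta>z: "\<theta> z = \<one>" using c gc by (simp add: m_assoc)
    have zA: "z \<in> A" using A_factorI[OF subgroup.one_closed[OF P] hz(2)] c(2) by simp
    have hA: "h \<in> A" using hz(1) P_subset_A by blast
    have "\<theta> a = \<theta> h"
      using \<theta>_mult[OF hA zA] Ac[OF \<theta>A[OF hA]] hz(3) \<theta>z by simp
    then show ?thesis using hz(1) by blast
  qed
  have hom: "\<theta> \<in> hom (G\<lparr>carrier := P\<rparr>) G"
    using \<theta>_mult[OF subsetD[OF P_subset_A] subsetD[OF P_subset_A]]
      Ac[OF \<theta>A[OF subsetD[OF P_subset_A]]]
    by (intro homI) simp_all
  interpret \<theta>: group_hom "G\<lparr>carrier := P\<rparr>" G \<theta>
    using hom P by (simp add: group_hom_def group_hom_axioms_def subgroup_imp_group)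
  \<comment> \<open>If \<open>\<theta> h\<close> is in \<open>K\<close>, so is the conjugate of the
    noncentral \<open>g\<close> by \<open>h\<close>, which forces \<open>h\<close> into
    \<open>K\<close>. This gives both injectivity and the trivial intersection.\<close>
  have ker: "h = \<one>" if h: "h \<in> P" and z: "\<theta> h \<in> K" for h
  proof -
    have hc: "h \<in> carrier G" using h P_carrier by simp
    have "inv (\<theta> h) \<otimes> g \<in> K"
      using K z g(1) by (intro subgroup.m_closed subgroup.m_inv_closed)
    also have "inv (\<theta> h) \<otimes> g = h \<otimes> g \<otimes> inv h" using hc gc by (simp add: \<theta>_def group_word)
    finally have "h \<in> K" using central_if_conjugate[of g h] g hc by auto
    then show ?thesis using h triv by auto
  qed
  have "inj_on \<theta> P"
  proof (unfold \<theta>.inj_on_one_iff[simplified], intro allI impI)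
    fix h assume "h \<in> P" "\<theta> h = \<one>"
    then show "h = \<one>" using ker[of h] subgroup.one_closed[OF K] by simp
  qed
  then have mon: "\<theta> \<in> mon (G\<lparr>carrier := P\<rparr>) G" using hom by (simp add: mon_def)
  have sub: "subgroup (\<theta> ` P) G" using \<theta>.img_is_subgroup by simp
  have "x \<otimes> b \<otimes> inv x \<in> \<theta> ` P" if x: "x \<in> carrier G" and b: "b \<in> \<theta> ` P" for x b
  proof -
    obtain h where h: "h \<in> P" "b = \<theta> h" using b by auto
    obtain a k where ak: "a \<in> P" "k \<in> K" "x = k \<otimes> a" using x factor_KP by metis
    note c = P_carrier[OF h(1)] P_carrier[OF ak(1)] K_carrier[OF ak(2)] gc
    have hA: "h \<in> A" "a \<in> A" using h ak P_subset_A by auto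
    have bc: "b \<in> carrier G" using h(2) Ac[OF \<theta>A[OF hA(1)]] by simp
    \<comment> \<open>The \<open>P\<close>-part of \<open>x\<close> fixes \<open>b\<close> because
      \<open>A\<close> is abelian; the \<open>K\<close>-part passes through \<open>\<theta>\<close>
      because it commutes with \<open>g\<close>.\<close>
    have ab: "a \<otimes> b = b \<otimes> a" using A_comm[OF hA(2) \<theta>A[OF hA(1)]] h(2) by simp
    have "x \<otimes> b \<otimes> inv x = k \<otimes> (a \<otimes> b) \<otimes> inv a \<otimes> inv k"
      using c bc ak(3) by (simp add: group_word)
    also have "\<dots> = k \<otimes> b \<otimes> inv k"
      unfolding ab using c bc by (simp add: group_word)
    also have "\<dots> = \<theta> (k \<otimes> h \<otimes> inv k)"
    proof -
      have kg: "k \<otimes> g = g \<otimes> k" "inv g \<otimes> inv k = inv k \<otimes> inv g"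
        using K_comm ak(2) g(1) subgroup.m_inv_closed[OF K] by blast+
      have "\<theta> (k \<otimes> h \<otimes> inv k) = (g \<otimes> k) \<otimes> h \<otimes> (inv k \<otimes> inv g) \<otimes> (k \<otimes> inv h \<otimes> inv k)"
        using c by (simp add: \<theta>_def group_word)
      also have "\<dots> = (k \<otimes> g) \<otimes> h \<otimes> (inv g \<otimes> inv k) \<otimes> (k \<otimes> inv h \<otimes> inv k)" by (simp add: kg)
      also have "\<dots> = k \<otimes> \<theta> h \<otimes> inv k" using c by (simp add: \<theta>_def group_word)
      finally show ?thesis using h by simp
    qed
    \<comment> \<open>The conjugate of \<open>h\<close> by \<open>k\<close> is only known to lie in
      \<open>A\<close>; \<open>\<theta>P\<close> exchanges it for an element of
      \<open>P\<close>.\<close>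
    finally show ?thesis using \<theta>P[OF A_conj[OF hA(1) c(3)]] by auto
  qed
  then have "\<theta> ` P \<lhd> G" using sub normal_inv_iff by auto
  moreover have "\<theta> ` P \<inter> K = {\<one>}"
  proof
    show "\<theta> ` P \<inter> K \<subseteq> {\<one>}" using ker \<theta>.hom_one by fastforce
    show "{\<one>} \<subseteq> \<theta> ` P \<inter> K"
      using subgroup.one_closed[OF sub] subgroup.one_closed[OF K] by blast
  qed
  ultimately show ?thesis using mon by blast
qed

end

section \<open>From internal to external semidirect products\<close>

lemma iso_inv_into:
  assumes F: "F \<in> hom S G" and bij: "bij_betw F (carrier S) (carrier G)"
    and closed: "\<And>x y. \<lbrakk>x \<in> carrier S; y \<in> carrier S\<rbrakk> \<Longrightarrow> x \<otimes>\<^bsub>S\<^esub> y \<in> carrier S"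
  shows "inv_into (carrier S) F \<in> iso G S"
proof (rule isoI)
  let ?F' = "inv_into (carrier S) F"
  have F': "?F' u \<in> carrier S" "F (?F' u) = u" if "u \<in> carrier G" for u
    using bij that by (auto simp: bij_betw_def inv_into_into f_inv_into_f)
  show "?F' \<in> hom G S"
  proof (rule homI)
    fix u v assume u: "u \<in> carrier G" and v: "v \<in> carrier G"
    have "F (?F' u \<otimes>\<^bsub>S\<^esub> ?F' v) = u \<otimes>\<^bsub>G\<^esub> v"
      using hom_mult[OF F F'(1)[OF u] F'(1)[OF v]] F'(2)[OF u] F'(2)[OF v] by simp
    then show "?F' (u \<otimes>\<^bsub>G\<^esub> v) = ?F' u \<otimes>\<^bsub>S\<^esub> ?F' v"
      using inv_into_f_f[OF bij_betw_imp_inj_on[OF bij] closed[OF F'(1)[OF u] F'(1)[OF v]]] by simp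
  qed (use F' in blast)
  show "bij_betw ?F' (carrier G) (carrier S)" using bij by (rule bij_betw_inv_into)
qed

context group
begin

text \<open>The action is conjugation by \<open>j y\<close>, pulled back along \<open>f\<close>; the
  isomorphism is the inverse of the map sending a pair to \<open>f x \<otimes> j y\<close>.\<close>

lemma internal_semidirect_product:
  assumes M: "group M" and N: "group N" and f: "f \<in> mon M G" and j: "j \<in> mon N G"
    and normal: "f ` carrier M \<lhd> G" and triv: "f ` carrier M \<inter> j ` carrier N = {\<one>}"
    and fin: "finite (carrier G)" and ord: "order G = order M * order N"
  shows "\<exists>\<phi>\<in>hom N (AutoGroup M). G \<cong> semidirect_product M N \<phi>"
proof -
  interpret M: group M by fact
  interpret N: group N by fact
  interpret f: group_hom M G f
    using f by (simp add: mon_def group_hom_def group_hom_axioms_def is_group M)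
  interpret j: group_hom N G j
    using j by (simp add: mon_def group_hom_def group_hom_axioms_def is_group N)
  have f_inj: "inj_on f (carrier M)" and j_inj: "inj_on j (carrier N)"
    using f j by (auto simp: mon_def)
  define c where "c y x = inv_into (carrier M) f (j y \<otimes> f x \<otimes> inv (j y))" for y x
  have c: "c y x \<in> carrier M" "f (c y x) = j y \<otimes> f x \<otimes> inv (j y)"
    if "y \<in> carrier N" "x \<in> carrier M" for y x
  proof -
    have "j y \<otimes> f x \<otimes> inv (j y) \<in> f ` carrier M"
      using normal that unfolding normal_inv_iff by simp
    then show "c y x \<in> carrier M" "f (c y x) = j y \<otimes> f x \<otimes> inv (j y)"
      unfolding c_def by (rule inv_into_into, rule f_inv_into_f)
  qed
  have c_hom: "c y (x \<otimes>\<^bsub>M\<^esub> x') = c y x \<otimes>\<^bsub>M\<^esub> c y x'"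
    if "y \<in> carrier N" "x \<in> carrier M" "x' \<in> carrier M" for y x x'
    \<comment> \<open>Identities for \<open>c\<close> are checked after applying the injective
      \<open>f\<close>, where they become identities between conjugates.\<close>
    by (rule inj_onD[OF f_inj]) (use that in \<open>simp_all add: c group_word\<close>)
  have c_mult: "c (y \<otimes>\<^bsub>N\<^esub> y') x = c y (c y' x)"
    if "y \<in> carrier N" "y' \<in> carrier N" "x \<in> carrier M" for y y' x
    by (rule inj_onD[OF f_inj]) (use that in \<open>simp_all add: c group_word\<close>)
  have c_one: "c \<one>\<^bsub>N\<^esub> x = x" if "x \<in> carrier M" for x
    by (rule inj_onD[OF f_inj]) (use that in \<open>simp_all add: c\<close>)
  \<comment> \<open>\<open>Bij\<close> admits only extensional functions, hence the
    restriction.\<close>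
  define \<phi> where "\<phi> y = restrict (c y) (carrier M)" for y
  have Bij: "\<phi> y \<in> Bij (carrier M)" if y: "y \<in> carrier N" for y
  proof -
    have "bij_betw (c y) (carrier M) (carrier M)"
      by (rule bij_betw_byWitness[where f' = "c (inv\<^bsub>N\<^esub> y)"])
        (use y in \<open>auto simp: c c_one simp flip: c_mult\<close>)
    then show ?thesis by (simp add: Bij_def \<phi>_def bij_betw_restrict_eq)
  qed
  have auto: "\<phi> y \<in> auto M" if y: "y \<in> carrier N" for y
    using Bij[OF y] y by (auto simp: auto_def \<phi>_def c c_hom intro!: homI)
  have \<phi>: "\<phi> \<in> hom N (AutoGroup M)"
  proof (rule homI)
    fix y y' assume y: "y \<in> carrier N" "y' \<in> carrier N"
    have "\<phi> (y \<otimes>\<^bsub>N\<^esub> y') = compose (carrier M) (\<phi> y) (\<phi> y')"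
      using y by (auto simp: compose_def \<phi>_def c c_mult)
    then show "\<phi> (y \<otimes>\<^bsub>N\<^esub> y') = \<phi> y \<otimes>\<^bsub>AutoGroup M\<^esub> \<phi> y'"
      using Bij y by (simp add: AutoGroup_def BijGroup_def)
  qed (simp add: AutoGroup_def auto)
  let ?S = "semidirect_product M N \<phi>" and ?m = "\<lambda>(a, b). a \<otimes> b"
  have subs: "subgroup (f ` carrier M) G" "subgroup (j ` carrier N) G"
    using f.img_is_subgroup j.img_is_subgroup .
  have ord': "order G = card (f ` carrier M) * card (j ` carrier N)"
    using ord by (simp add: card_image f_inj j_inj order_def)
  have "bij_betw (?m \<circ> map_prod f j) (carrier ?S) (carrier G)"
  proof (rule bij_betw_trans)
    show "bij_betw (map_prod f j) (carrier ?S) (f ` carrier M \<times> j ` carrier N)"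
      using bij_betw_map_prod[OF inj_on_imp_bij_betw[OF f_inj] inj_on_imp_bij_betw[OF j_inj]]
      by (simp add: semidirect_product_def)
    show "bij_betw ?m (f ` carrier M \<times> j ` carrier N) (carrier G)"
      using mult_inj_on_Times[OF subs triv] complement_factor[OF subs triv fin ord']
      by (simp add: bij_betw_def)
  qed
  moreover have "?m \<circ> map_prod f j \<in> hom ?S G"
    by (rule homI) (auto simp: semidirect_product_def \<phi>_def c group_word)
  ultimately have "inv_into (carrier ?S) (?m \<circ> map_prod f j) \<in> iso G ?S"
    by (intro iso_inv_into) (auto simp: semidirect_product_def \<phi>_def c)
  then show ?thesis using \<phi> by (auto simp: is_iso_def)
qed

text \<open>If the image of \<open>N\<close> is normal, \<open>N\<close> is the normal factor.
  Otherwise \<open>normal_complement\<close> turns \<open>i\<close> into another embedding of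
  \<open>M\<close>, now with normal image.\<close>

lemma prime_complement_semidirect:
  assumes M: "comm_group M" and N: "comm_group N" and i: "i \<in> mon M G" and j: "j \<in> mon N G"
    and triv: "i ` carrier M \<inter> j ` carrier N = {\<one>}"
    and fin: "finite (carrier G)" and ord: "order G = order M * order N"
    and p: "Factorial_Ring.prime (order M)"
  shows "(\<exists>\<phi>\<in>hom N (AutoGroup M). G \<cong> semidirect_product M N \<phi>)
    \<or> (\<exists>\<psi>\<in>hom M (AutoGroup N). G \<cong> semidirect_product N M \<psi>)"
proof -
  interpret M: comm_group M by fact
  interpret N: comm_group N by fact
  interpret i: group_hom M G i
    using i by (simp add: mon_def group_hom_def group_hom_axioms_def is_group M.is_group)
  interpret j: group_hom N G j
    using j by (simp add: mon_def group_hom_def group_hom_axioms_def is_group N.is_group)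
  have card: "card (i ` carrier M) = order M" "card (j ` carrier N) = order N"
    using i j by (auto simp: mon_def order_def card_image)
  show ?thesis
  proof (cases "j ` carrier N \<lhd> G")
    case True
    then show ?thesis
      using internal_semidirect_product[OF N.is_group M.is_group j i True _ fin] triv ord
      by (simp add: Int_commute mult.commute)
  next
    case False
    interpret compl: non_normal_complement G "i ` carrier M" "j ` carrier N" "order M"
    proof (intro non_normal_complement.intro non_normal_complement_axioms.intro is_group)
      show "x \<otimes> y = y \<otimes> x" if "x \<in> i ` carrier M" "y \<in> i ` carrier M" for x y
        using that M.m_comm by (auto simp flip: i.hom_mult)
      show "x \<otimes> y = y \<otimes> x" if "x \<in> j ` carrier N" "y \<in> j ` carrier N" for x y
        using that N.m_comm by (auto simp flip: j.hom_mult)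
    qed (use False assms card i.img_is_subgroup j.img_is_subgroup in simp_all)
    obtain \<theta> where \<theta>: "\<theta> \<in> mon (G\<lparr>carrier := i ` carrier M\<rparr>) G"
      "\<theta> ` i ` carrier M \<lhd> G" "\<theta> ` i ` carrier M \<inter> j ` carrier N = {\<one>}"
      using compl.normal_complement by blast
    have "i \<in> mon M (G\<lparr>carrier := i ` carrier M\<rparr>)"
      using i by (auto simp: mon_def hom_def)
    then have "\<theta> \<circ> i \<in> mon M G" using \<theta>(1) by (rule mon_compose)
    then show ?thesis
      using internal_semidirect_product[OF M.is_group N.is_group _ j _ _ fin ord, of "\<theta> \<circ> i"] \<theta>(2,3)
      by (simp add: image_comp)
  qed
qed

end

section \<open>Bicrossed products of cyclic groups\<close>

theorem theorem2p1:
  fixes p m :: nat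
    and H :: "('h, 'x) monoid_scheme" and G :: "('g, 'y) monoid_scheme"
    and \<alpha> :: "'g \<Rightarrow> 'h \<Rightarrow> 'h" and \<beta> :: "'g \<Rightarrow> 'h \<Rightarrow> 'g"
  assumes "Factorial_Ring.prime p" and "m \<ge> 2"
    and "matched_pair H G \<alpha> \<beta>"
    and "cyclic_group H" and "cyclic_group G"
    and "order H = p \<and> order G = m \<or> order H = m \<and> order G = p"
  shows "(\<exists>\<phi> \<in> hom G (AutoGroup H). bicrossed_product H G \<alpha> \<beta> \<cong> semidirect_product H G \<phi>)
    \<or> (\<exists>\<psi> \<in> hom H (AutoGroup G). bicrossed_product H G \<alpha> \<beta> \<cong> semidirect_product G H \<psi>)"
proof -
  let ?E = "bicrossed_product H G \<alpha> \<beta>"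
  interpret matched_pair H G \<alpha> \<beta> by fact
  interpret E: group ?E by (rule bicrossed_product_group)
  have comm: "comm_group H" "comm_group G"
    using assms by (auto intro: H.cyclic_imp_abelian_group G.cyclic_imp_abelian_group)
  \<comment> \<open>An infinite carrier has order 0 by convention, so positive orders give
    finiteness.\<close>
  have "order H > 0" "order G > 0"
    using assms prime_gt_0_nat by auto
  then have fin: "finite (carrier ?E)"
    by (auto simp: bicrossed_product_def order_def card_gt_0_iff)
  have ordE: "order ?E = order H * order G"
    by (simp add: bicrossed_product_def order_def card_cartesian_product)
  let ?i = "\<lambda>h. (h, \<one>\<^bsub>G\<^esub>)" and ?j = "\<lambda>g. (\<one>\<^bsub>H\<^esub>, g)"
  \<comment> \<open>The coordinate embeddings are homomorphisms because units act trivially and are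
    fixed by both actions.\<close>
  have i: "?i \<in> mon H ?E"
    by (auto simp: mon_def hom_def inj_on_def bicrossed_product_def left_act_one right_act_unit)
  have j: "?j \<in> mon G ?E"
    by (auto simp: mon_def hom_def inj_on_def bicrossed_product_def left_act_unit right.right_act_one)
  have triv: "?i ` carrier H \<inter> ?j ` carrier G = {\<one>\<^bsub>?E\<^esub>}"
    by (auto simp: bicrossed_product_def)
  from assms(6) show ?thesis
  proof
    assume "order H = p \<and> order G = m"
    then show ?thesis
      using E.prime_complement_semidirect[OF comm i j triv fin ordE] assms(1) by auto
  next
    assume *: "order H = m \<and> order G = p"
    \<comment> \<open>\<open>prime_complement_semidirect\<close> expects the factor of prime order
      first, so the two embeddings change places.\<close>
    have "?j ` carrier G \<inter> ?i ` carrier H = {\<one>\<^bsub>?E\<^esub>}" "order ?E = order G * order H"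
      using triv ordE by (simp_all add: Int_commute mult.commute)
    then show ?thesis
      using E.prime_complement_semidirect[OF comm(2,1) j i _ fin] * assms(1) by blast
  qed
qed

end
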